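(* Let $\mathbf{k}$ be a commutative ring with unit. For every $T\in H_{\rm LR}^{\epsilon}$, one has $$\Delta_{\rm LR}^{\epsilon}(B^{r}(T))=T\otimes|+(\mathrm{id}\otimes B^{r})\Delta_{\rm LR}^{\epsilon}(T)$$ and $$\Delta_{\rm LR}^{\epsilon}(B^{\ell}(T))=|\otimes T+(B^{\ell}\otimes\mathrm{id})\Delta_{\rm LR}^{\epsilon}(T).$$
   Context: All modules, tensor products and linear maps are over $\mathbf{k}$. Planar binary trees: a planar binary tree is a finite rooted planar tree in which every internal vertex has exactly two ordered incoming branches (left and right). The trivial tree, with no internal vertices, is denoted $|$. Let $\mathcal{Y}$ be the set of planar binary trees and $H_{\rm LR}^{\epsilon}:=\mathbf{k}\mathcal{Y}$ the free $\mathbf{k}$-module on it. Grafting: for $T_l,T_r\in\mathcal{Y}$, $T_l\vee T_r$ is the tree obtained by creating a new root with left branch $T_l$ and right branch $T_r$; $\vee$ is extended bilinearly. Every $T\in\mathcal{Y}$ with $T\neq |$ is uniquely of the form $T=T_l\vee T_r$. One-sided grafting operators: $B^{r},B^{\ell}:H_{\rm LR}^{\epsilon}\to H_{\rm LR}^{\epsilon}$ are the linear maps with $B^{r}(T)=T\vee|$ and $B^{\ell}(T)=|\vee T$ for $T\in\mathcal{Y}$. Infinitesimal coproduct: the linear map $\Delta_{\rm LR}^{\epsilon}:H_{\rm LR}^{\epsilon}\to H_{\rm LR}^{\epsilon}\otimes H_{\rm LR}^{\epsilon}$ defined on trees recursively by $\Delta_{\rm LR}^{\epsilon}(|)=0$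 and $$\Delta_{\rm LR}^{\epsilon}(T_l\vee T_r)=T_l\otimes T_r+(\mathrm{id}\otimes\vee)(\Delta_{\rm LR}^{\epsilon}(T_l)\otimes T_r)+(\vee\otimes\mathrm{id})(T_l\otimes\Delta_{\rm LR}^{\epsilon}(T_r)).$$ *)

theory Defs
  imports "HOL-Library.Poly_Mapping"
begin

section \<open>Modules and linear maps over a commutative unital ring\<close>

text \<open>
  The sort \<open>{comm_ring, comm_monoid_mult}\<close> consists of the commutative rings with unit,
  including the zero ring, which the class \<open>comm_ring_1\<close> (and with it the locale \<open>module\<close>)
  excludes. The locale below is \<open>module\<close> without that restriction.
\<close>

locale unital_module =
  fixes scale :: "'k::{comm_ring, comm_monoid_mult} \<Rightarrow> 'm::ab_group_add \<Rightarrow> 'm"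
  assumes scale_add_right: "scale c (x + y) = scale c x + scale c y"
    and scale_add_left: "scale (c + d) x = scale c x + scale d x"
    and scale_scale: "scale c (scale d x) = scale (c * d) x"
    and scale_one: "scale 1 x = x"
begin

lemma scale_zero_left: "scale 0 x = 0"
  using scale_add_left[of 0 0 x] by simp

lemma scale_zero_right: "scale c 0 = 0"
  using scale_add_right[of c 0 0] by simp

lemma scale_sum: "scale c (sum f A) = (\<Sum>a\<in>A. scale c (f a))"
  by (induction A rule: infinite_finite_induct) (auto simp: scale_zero_right scale_add_right)

end

definition is_linear ::
  "('k \<Rightarrow> 'm::plus \<Rightarrow> 'm) \<Rightarrow> ('k \<Rightarrow> 'n::plus \<Rightarrow> 'n) \<Rightarrow> ('m \<Rightarrow> 'n) \<Rightarrow> bool" where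
  "is_linear s t f \<longleftrightarrow> (\<forall>x y. f (x + y) = f x + f y) \<and> (\<forall>c x. f (s c x) = t c (f x))"

section \<open>Free modules\<close>

text \<open>The free module on a type \<open>'a\<close> of basis elements is \<open>'a \<Rightarrow>\<^sub>0 'k\<close>.\<close>

definition smul :: "'k \<Rightarrow> ('a \<Rightarrow>\<^sub>0 'k) \<Rightarrow> ('a \<Rightarrow>\<^sub>0 'k::{comm_ring, comm_monoid_mult})" where
  "smul c x = Poly_Mapping.map ((*) c) x"

definition basis :: "'a \<Rightarrow> ('a \<Rightarrow>\<^sub>0 'k::{comm_ring, comm_monoid_mult})" where
  "basis a = Poly_Mapping.single a 1"

definition lin_ext ::
  "('k::{comm_ring, comm_monoid_mult} \<Rightarrow> 'm \<Rightarrow> 'm) \<Rightarrow> ('a \<Rightarrow> 'm::ab_group_add) \<Rightarrow> ('a \<Rightarrow>\<^sub>0 'k) \<Rightarrow> 'm" where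
  "lin_ext s f x = (\<Sum>a\<in>Poly_Mapping.keys x. s (Poly_Mapping.lookup x a) (f a))"

abbreviation lin ::
  "('a \<Rightarrow> ('b \<Rightarrow>\<^sub>0 'k)) \<Rightarrow> ('a \<Rightarrow>\<^sub>0 'k) \<Rightarrow> ('b \<Rightarrow>\<^sub>0 'k::{comm_ring, comm_monoid_mult})" where
  "lin \<equiv> lin_ext smul"

abbreviation linear_free ::
  "(('a \<Rightarrow>\<^sub>0 'k) \<Rightarrow> ('b \<Rightarrow>\<^sub>0 'k::{comm_ring, comm_monoid_mult})) \<Rightarrow> bool" where
  "linear_free \<equiv> is_linear smul smul"

lemma lookup_smul [simp]: "Poly_Mapping.lookup (smul c x) a = c * Poly_Mapping.lookup x a"
  by (simp add: smul_def Poly_Mapping.map.rep_eq when_def)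

lemma unital_module_smul: "unital_module smul"
  by unfold_locales (auto intro!: poly_mapping_eqI simp: lookup_add algebra_simps)

lemma smul_zero [simp]: "smul 0 x = 0" "smul c 0 = 0"
  by (auto intro!: poly_mapping_eqI)

lemma smul_one [simp]: "smul 1 x = x"
  by (auto intro!: poly_mapping_eqI)

lemma lookup_basis: "Poly_Mapping.lookup (basis a) b = (if a = b then 1 else 0)"
  by (simp add: basis_def lookup_single when_def)

lemma basis_expansion:
  "x = (\<Sum>a\<in>Poly_Mapping.keys x. smul (Poly_Mapping.lookup x a) (basis a))"
  by (rule poly_mapping_eqI)
    (auto simp: lookup_sum lookup_basis if_distrib sum.delta' in_keys_iff cong: if_cong)

lemma (in unital_module) lin_ext_superset:
  assumes "finite A" "Poly_Mapping.keys x \<subseteq> A"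
  shows "lin_ext scale f x = (\<Sum>a\<in>A. scale (Poly_Mapping.lookup x a) (f a))"
  unfolding lin_ext_def using assms
  by (intro sum.mono_neutral_left) (auto simp: in_keys_iff scale_zero_left)

lemma (in unital_module) lin_ext_linear: "is_linear smul scale (lin_ext scale f)"
  unfolding is_linear_def
proof (intro conjI allI)
  fix x y :: "'a \<Rightarrow>\<^sub>0 'k"
  let ?A = "Poly_Mapping.keys x \<union> Poly_Mapping.keys y"
  have "Poly_Mapping.keys (x + y) \<subseteq> ?A" by (rule keys_add)
  then show "lin_ext scale f (x + y) = lin_ext scale f x + lin_ext scale f y"
    by (simp add: lin_ext_superset[of ?A] lookup_add scale_add_left sum.distrib)
next
  fix c and x :: "'a \<Rightarrow>\<^sub>0 'k"
  have "Poly_Mapping.keys (smul c x) \<subseteq> Poly_Mapping.keys x"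
    by (auto simp: in_keys_iff)
  then show "lin_ext scale f (smul c x) = scale c (lin_ext scale f x)"
    by (simp add: lin_ext_superset[of "Poly_Mapping.keys x"] scale_sum scale_scale)
qed

lemma (in unital_module) lin_ext_basis: "lin_ext scale f (basis a) = f a"
  by (subst lin_ext_superset[of "{a}"])
    (auto simp: basis_def scale_one)

lemma (in unital_module) is_linear_sum:
  assumes "is_linear smul scale f"
  shows "f (\<Sum>a\<in>A. g a) = (\<Sum>a\<in>A. f (g a))"
proof -
  have "f 0 = 0"
    using assms unfolding is_linear_def by (metis smul_zero(1) scale_zero_left)
  then show ?thesis
    using assms by (induction A rule: infinite_finite_induct) (auto simp: is_linear_def)
qed

lemma (in unital_module) lin_ext_unique:
  assumes "is_linear smul scale f"
  shows "f = lin_ext scale (\<lambda>a. f (basis a))"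
proof
  fix x
  have "f x = f (\<Sum>a\<in>Poly_Mapping.keys x. smul (Poly_Mapping.lookup x a) (basis a))"
    using basis_expansion[of x] by simp
  also have "\<dots> = lin_ext scale (\<lambda>a. f (basis a)) x"
    using assms by (simp add: is_linear_sum lin_ext_def is_linear_def)
  finally show "f x = lin_ext scale (\<lambda>a. f (basis a)) x" .
qed

lemmas lin_linear = unital_module.lin_ext_linear[OF unital_module_smul]
lemmas lin_basis = unital_module.lin_ext_basis[OF unital_module_smul]
lemmas lin_unique = unital_module.lin_ext_unique[OF unital_module_smul]

section \<open>Tensor products of free modules\<close>

text \<open>
  The tensor product of the free modules on \<open>'a\<close> and on \<open>'b\<close> is realised as the free module on
  \<open>'a \<times> 'b\<close>, with \<open>\<otimes>\<close> the bilinear extension of \<open>(a, b) \<mapsto> (a, b)\<close>. The theorem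
  \<open>tensor_universal\<close> is its universal property with respect to bilinear maps into arbitrary
  modules.
\<close>

definition tensor ::
  "('a \<Rightarrow>\<^sub>0 'k) \<Rightarrow> ('b \<Rightarrow>\<^sub>0 'k) \<Rightarrow> ('a \<times> 'b \<Rightarrow>\<^sub>0 'k::{comm_ring, comm_monoid_mult})"
  (infixr "\<otimes>" 75) where
  "x \<otimes> y = lin (\<lambda>a. lin (\<lambda>b. basis (a, b)) y) x"

lemma tensor_basis: "basis a \<otimes> basis b = basis (a, b)"
  by (simp add: tensor_def lin_basis)

lemma tensor_linear_left: "linear_free (\<lambda>x. x \<otimes> y)"
  unfolding tensor_def by (rule lin_linear)

lemma lin_pointwise_add: "lin (\<lambda>a. f a + g a) x = lin f x + lin g x"
  by (simp add: lin_ext_def unital_module.scale_add_right[OF unital_module_smul] sum.distrib)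

lemma lin_pointwise_smul: "lin (\<lambda>a. smul c (f a)) x = smul c (lin f x)"
  by (simp add: lin_ext_def unital_module.scale_sum[OF unital_module_smul]
      unital_module.scale_scale[OF unital_module_smul] mult.commute)

lemma tensor_linear_right:
  fixes x :: "'b \<Rightarrow>\<^sub>0 'k::{comm_ring, comm_monoid_mult}"
  shows "linear_free (\<lambda>y. (x \<otimes> y :: 'b \<times> 'a \<Rightarrow>\<^sub>0 'k))"
proof -
  have "lin f (y + z) = lin f y + lin f z" "lin f (smul c y) = smul c (lin f y)"
    for f :: "'a \<Rightarrow> ('b \<times> 'a \<Rightarrow>\<^sub>0 'k)" and c y z
    using lin_linear[of f] by (auto simp: is_linear_def)
  then show ?thesis
    unfolding tensor_def is_linear_def
    by (simp add: lin_pointwise_add lin_pointwise_smul)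
qed

lemmas tensor_simps =
  tensor_linear_left[unfolded is_linear_def, THEN conjunct1, rule_format]
  tensor_linear_left[unfolded is_linear_def, THEN conjunct2, rule_format]
  tensor_linear_right[unfolded is_linear_def, THEN conjunct1, rule_format]
  tensor_linear_right[unfolded is_linear_def, THEN conjunct2, rule_format]

definition is_bilinear ::
  "('k::{comm_ring, comm_monoid_mult} \<Rightarrow> 'm \<Rightarrow> 'm) \<Rightarrow>
    (('a \<Rightarrow>\<^sub>0 'k) \<Rightarrow> ('b \<Rightarrow>\<^sub>0 'k) \<Rightarrow> 'm::ab_group_add) \<Rightarrow> bool" where
  "is_bilinear s \<beta> \<longleftrightarrow>
    (\<forall>y. is_linear smul s (\<lambda>x. \<beta> x y)) \<and> (\<forall>x. is_linear smul s (\<lambda>y. \<beta> x y))"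

lemma bilinear_tensor: "is_bilinear smul (\<otimes>)"
  by (simp add: is_bilinear_def tensor_linear_left tensor_linear_right)

lemma is_linear_comp:
  "is_linear s t f \<Longrightarrow> is_linear t u g \<Longrightarrow> is_linear s u (\<lambda>x. g (f x))"
  by (simp add: is_linear_def)

lemma (in unital_module) bilinear_eqI:
  assumes "is_bilinear scale \<beta>" "is_bilinear scale \<gamma>"
    and "\<And>a b. \<beta> (basis a) (basis b) = \<gamma> (basis a) (basis b)"
  shows "\<beta> x y = \<gamma> x y"
proof -
  have "\<beta> (basis a) = \<gamma> (basis a)" for a
  proof -
    have "\<beta> (basis a) = lin_ext scale (\<lambda>b. \<beta> (basis a) (basis b))"
      using assms(1) unfolding is_bilinear_def by (intro lin_ext_unique) simp
    also have "\<dots> = lin_ext scale (\<lambda>b. \<gamma> (basis a) (basis b))"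
      by (simp only: assms(3))
    also have "\<dots> = \<gamma> (basis a)"
      using assms(2) unfolding is_bilinear_def by (intro lin_ext_unique[symmetric]) simp
    finally show ?thesis .
  qed
  then have *: "(\<lambda>a. \<beta> (basis a) y) = (\<lambda>a. \<gamma> (basis a) y)"
    by simp
  have "(\<lambda>x. \<beta> x y) = lin_ext scale (\<lambda>a. \<beta> (basis a) y)"
    by (rule lin_ext_unique) (use assms(1) in \<open>simp add: is_bilinear_def\<close>)
  also have "\<dots> = lin_ext scale (\<lambda>a. \<gamma> (basis a) y)"
    by (simp only: *)
  also have "\<dots> = (\<lambda>x. \<gamma> x y)"
    by (rule lin_ext_unique[symmetric]) (use assms(2) in \<open>simp add: is_bilinear_def\<close>)
  finally show ?thesis by (rule fun_cong)
qed

theorem (in unital_module) tensor_universal: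
  assumes "is_bilinear scale \<beta>"
  shows "\<exists>!L. is_linear smul scale L \<and> (\<forall>x y. L (x \<otimes> y) = \<beta> x y)"
proof (rule ex1I)
  let ?L = "lin_ext scale (\<lambda>(a, b). \<beta> (basis a) (basis b))"
  have "is_bilinear scale (\<lambda>x y. ?L (x \<otimes> y))"
    unfolding is_bilinear_def
    using is_linear_comp[OF tensor_linear_left lin_ext_linear]
      is_linear_comp[OF tensor_linear_right lin_ext_linear] by blast
  then have "?L (x \<otimes> y) = \<beta> x y" for x y
    using assms by (rule bilinear_eqI) (simp add: tensor_basis lin_ext_basis)
  then show "is_linear smul scale ?L \<and> (\<forall>x y. ?L (x \<otimes> y) = \<beta> x y)"
    using lin_ext_linear by blast
  fix L assume L: "is_linear smul scale L \<and> (\<forall>x y. L (x \<otimes> y) = \<beta> x y)"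
  have "(\<lambda>p. L (basis p)) = (\<lambda>(a, b). \<beta> (basis a) (basis b))"
  proof
    fix p :: "'a \<times> 'b"
    obtain a b where "p = (a, b)" by fastforce
    then show "L (basis p) = (case p of (a, b) \<Rightarrow> \<beta> (basis a) (basis b))"
      using L by (simp flip: tensor_basis)
  qed
  moreover have "L = lin_ext scale (\<lambda>p. L (basis p))"
    using L by (intro lin_ext_unique) simp
  ultimately show "L = ?L" by (simp only:)
qed

definition tensor_map ::
  "(('a \<Rightarrow>\<^sub>0 'k) \<Rightarrow> ('c \<Rightarrow>\<^sub>0 'k)) \<Rightarrow> (('b \<Rightarrow>\<^sub>0 'k) \<Rightarrow> ('d \<Rightarrow>\<^sub>0 'k)) \<Rightarrow>
    ('a \<times> 'b \<Rightarrow>\<^sub>0 'k) \<Rightarrow> ('c \<times> 'd \<Rightarrow>\<^sub>0 'k::{comm_ring, comm_monoid_mult})"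
  (infixr "\<otimes>\<^sub>m" 75) where
  "f \<otimes>\<^sub>m g = lin (\<lambda>(a, b). f (basis a) \<otimes> g (basis b))"

lemma tensor_map_linear: "linear_free (f \<otimes>\<^sub>m g)"
  unfolding tensor_map_def by (rule lin_linear)

lemma tensor_map_tensor:
  assumes "linear_free f" "linear_free g"
  shows "(f \<otimes>\<^sub>m g) (x \<otimes> y) = f x \<otimes> g y"
  by (rule unital_module.bilinear_eqI[OF unital_module_smul,
        where \<beta> = "\<lambda>x y. (f \<otimes>\<^sub>m g) (x \<otimes> y)" and \<gamma> = "\<lambda>x y. f x \<otimes> g y"])
    (use assms tensor_map_linear[of f g] in \<open>auto simp: is_bilinear_def is_linear_def tensor_simps
      tensor_basis tensor_map_def lin_basis\<close>)

definition assoc ::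
  "(('a \<times> 'b) \<times> 'c \<Rightarrow>\<^sub>0 'k) \<Rightarrow> ('a \<times> 'b \<times> 'c \<Rightarrow>\<^sub>0 'k::{comm_ring, comm_monoid_mult})" where
  "assoc = lin (\<lambda>((a, b), c). basis (a, b, c))"

definition assoc_inv ::
  "('a \<times> 'b \<times> 'c \<Rightarrow>\<^sub>0 'k) \<Rightarrow> (('a \<times> 'b) \<times> 'c \<Rightarrow>\<^sub>0 'k::{comm_ring, comm_monoid_mult})" where
  "assoc_inv = lin (\<lambda>(a, b, c). basis ((a, b), c))"

lemma linear_free_eqI:
  assumes "linear_free f" "linear_free g" "\<And>a. f (basis a) = g (basis a)"
  shows "f x = g x"
proof -
  have "f = lin (\<lambda>a. f (basis a))" by (rule lin_unique[OF assms(1)])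
  also have "\<dots> = lin (\<lambda>a. g (basis a))" by (simp only: assms(3))
  also have "\<dots> = g" by (rule lin_unique[OF assms(2), symmetric])
  finally show ?thesis by (rule fun_cong)
qed

lemma trilinear_ext:
  assumes "\<And>y z. linear_free (\<lambda>x. \<beta> x y z)" "\<And>x z. linear_free (\<lambda>y. \<beta> x y z)"
    and "\<And>x y. linear_free (\<lambda>z. \<beta> x y z)"
    and "\<And>y z. linear_free (\<lambda>x. \<gamma> x y z)" "\<And>x z. linear_free (\<lambda>y. \<gamma> x y z)"
    and "\<And>x y. linear_free (\<lambda>z. \<gamma> x y z)"
    and "\<And>a b c. \<beta> (basis a) (basis b) (basis c) = \<gamma> (basis a) (basis b) (basis c)"
  shows "\<beta> x y z = \<gamma> x y z"
proof -
  have "\<beta> x y (basis c) = \<gamma> x y (basis c)" for c x y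
    by (rule unital_module.bilinear_eqI[OF unital_module_smul])
      (use assms in \<open>auto simp: is_bilinear_def\<close>)
  then show ?thesis by (rule linear_free_eqI[OF assms(3,6)])
qed

lemma assoc_tensor: "assoc ((x \<otimes> y) \<otimes> z) = x \<otimes> (y \<otimes> z)"
  by (rule trilinear_ext[where \<beta> = "\<lambda>x y z. assoc ((x \<otimes> y) \<otimes> z)" and \<gamma> = "\<lambda>x y z. x \<otimes> (y \<otimes> z)"])
    (use lin_linear[of "\<lambda>((a, b), c). basis (a, b, c)"] in
      \<open>auto simp: is_linear_def tensor_simps tensor_basis assoc_def lin_basis\<close>)

lemma assoc_inv_assoc: "assoc_inv (assoc t) = t"
proof -
  have "linear_free (\<lambda>t. assoc_inv (assoc t))"
    unfolding assoc_def assoc_inv_def by (rule is_linear_comp[OF lin_linear lin_linear])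
  moreover have "linear_free (\<lambda>t. t)" by (simp add: is_linear_def)
  moreover have "assoc_inv (assoc (basis p)) = basis p" for p :: "('a \<times> 'b) \<times> 'c"
    by (cases p) (auto simp: assoc_def assoc_inv_def lin_basis)
  ultimately show ?thesis by (rule linear_free_eqI)
qed

lemma assoc_inv_tensor: "assoc_inv (x \<otimes> (y \<otimes> z)) = (x \<otimes> y) \<otimes> z"
  by (metis assoc_inv_assoc assoc_tensor)

section \<open>Planar binary trees and the infinitesimal coproduct\<close>

datatype pbtree = Triv | Graft pbtree pbtree

text \<open>The linear map \<open>H \<otimes> H \<rightarrow> H\<close> induced by the bilinear extension of grafting.\<close>

definition vee :: "(pbtree \<times> pbtree \<Rightarrow>\<^sub>0 'k) \<Rightarrow> (pbtree \<Rightarrow>\<^sub>0 'k::{comm_ring, comm_monoid_mult})" where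
  "vee = lin (\<lambda>(l, r). basis (Graft l r))"

lemma vee_basis: "vee (basis l \<otimes> basis r) = basis (Graft l r)"
  by (simp add: vee_def tensor_basis lin_basis)

definition B_right :: "(pbtree \<Rightarrow>\<^sub>0 'k) \<Rightarrow> (pbtree \<Rightarrow>\<^sub>0 'k::{comm_ring, comm_monoid_mult})" where
  "B_right = lin (\<lambda>T. basis (Graft T Triv))"

definition B_left :: "(pbtree \<Rightarrow>\<^sub>0 'k) \<Rightarrow> (pbtree \<Rightarrow>\<^sub>0 'k::{comm_ring, comm_monoid_mult})" where
  "B_left = lin (\<lambda>T. basis (Graft Triv T))"

primrec coproduct_tree ::
  "pbtree \<Rightarrow> (pbtree \<times> pbtree \<Rightarrow>\<^sub>0 'k::{comm_ring, comm_monoid_mult})" where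
  "coproduct_tree Triv = 0"
| "coproduct_tree (Graft l r) =
    basis l \<otimes> basis r
    + (id \<otimes>\<^sub>m vee) (assoc (coproduct_tree l \<otimes> basis r))
    + (vee \<otimes>\<^sub>m id) (assoc_inv (basis l \<otimes> coproduct_tree r))"

definition coproduct ::
  "(pbtree \<Rightarrow>\<^sub>0 'k) \<Rightarrow> (pbtree \<times> pbtree \<Rightarrow>\<^sub>0 'k::{comm_ring, comm_monoid_mult})" where
  "coproduct = lin coproduct_tree"

end

theory Submission
  imports Defs
begin

text \<open>
  All four expressions are linear in \<open>T\<close>, so each identity needs checking only on a single tree
  (\<open>linear_free_eqI\<close>). There it is the recursion for the coproduct of a grafting with one branch
  trivial: since \<open>\<Delta>(|) = 0\<close>, the term coming from the trivial branch disappears, and the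
  leading term and the term of the other branch remain. In the latter, grafting
  the fixed tree \<open>|\<close> onto one tensor factor is by definition what the one-sided operator does
  on that factor; this is the content of the two \<open>graft_Triv\<close> lemmas.
\<close>

lemma linear_free_add:
  assumes "linear_free f" "linear_free g"
  shows "linear_free (\<lambda>x. f x + g x)"
  using assms
  by (simp add: is_linear_def unital_module.scale_add_right[OF unital_module_smul] ac_simps)

lemma linear_free_zero: "linear_free f \<Longrightarrow> f 0 = 0"
  unfolding is_linear_def by (metis smul_zero(1))

lemma tensor_map_basis: "(f \<otimes>\<^sub>m g) (basis (a, b)) = f (basis a) \<otimes> g (basis b)"
  by (simp add: tensor_map_def lin_basis)

lemma linear_assoc: "linear_free assoc"
  unfolding assoc_def by (rule lin_linear)

lemma linear_assoc_inv: "linear_free assoc_inv"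
  unfolding assoc_inv_def by (rule lin_linear)

lemma linear_B_right: "linear_free B_right"
  unfolding B_right_def by (rule lin_linear)

lemma linear_B_left: "linear_free B_left"
  unfolding B_left_def by (rule lin_linear)

lemma linear_coproduct: "linear_free coproduct"
  unfolding coproduct_def by (rule lin_linear)

lemma B_right_basis: "B_right (basis t) = basis (Graft t Triv)"
  by (simp add: B_right_def lin_basis)

lemma B_left_basis: "B_left (basis t) = basis (Graft Triv t)"
  by (simp add: B_left_def lin_basis)

lemma coproduct_basis: "coproduct (basis t) = coproduct_tree t"
  by (simp add: coproduct_def lin_basis)

text \<open>
  On \<open>x \<otimes> y\<close> both sides are \<open>x \<otimes> (y \<or> |)\<close>. Since the coproduct of a tree is not a pure tensor
  in general, the equality is needed for an arbitrary \<open>u\<close>, and follows by linearity.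
\<close>

lemma right_graft_Triv:
  fixes u :: "'a \<times> pbtree \<Rightarrow>\<^sub>0 'k::{comm_ring, comm_monoid_mult}"
  shows "(id \<otimes>\<^sub>m vee) (assoc (u \<otimes> basis Triv)) = (id \<otimes>\<^sub>m B_right) u"
proof (rule linear_free_eqI[where f = "\<lambda>u. (id \<otimes>\<^sub>m vee) (assoc (u \<otimes> basis Triv))"])
  show "linear_free (\<lambda>u :: 'a \<times> pbtree \<Rightarrow>\<^sub>0 'k. (id \<otimes>\<^sub>m vee) (assoc (u \<otimes> basis Triv)))"
    by (intro is_linear_comp[OF is_linear_comp[OF tensor_linear_left linear_assoc]
          tensor_map_linear])
  show "linear_free (id \<otimes>\<^sub>m B_right :: ('a \<times> pbtree \<Rightarrow>\<^sub>0 'k) \<Rightarrow> _)"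
    by (rule tensor_map_linear)
  show "(id \<otimes>\<^sub>m vee) (assoc (basis p \<otimes> basis Triv)) = (id \<otimes>\<^sub>m B_right) (basis p :: _ \<Rightarrow>\<^sub>0 'k)"
    for p :: "'a \<times> pbtree"
    by (cases p)
      (simp add: assoc_def lin_basis tensor_basis tensor_map_basis vee_def B_right_basis)
qed

lemma left_graft_Triv:
  fixes u :: "pbtree \<times> 'a \<Rightarrow>\<^sub>0 'k::{comm_ring, comm_monoid_mult}"
  shows "(vee \<otimes>\<^sub>m id) (assoc_inv (basis Triv \<otimes> u)) = (B_left \<otimes>\<^sub>m id) u"
proof (rule linear_free_eqI[where f = "\<lambda>u. (vee \<otimes>\<^sub>m id) (assoc_inv (basis Triv \<otimes> u))"])
  show "linear_free (\<lambda>u :: pbtree \<times> 'a \<Rightarrow>\<^sub>0 'k. (vee \<otimes>\<^sub>m id) (assoc_inv (basis Triv \<otimes> u)))"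
    by (intro is_linear_comp[OF is_linear_comp[OF tensor_linear_right linear_assoc_inv]
          tensor_map_linear])
  show "linear_free (B_left \<otimes>\<^sub>m id :: (pbtree \<times> 'a \<Rightarrow>\<^sub>0 'k) \<Rightarrow> _)"
    by (rule tensor_map_linear)
  show "(vee \<otimes>\<^sub>m id) (assoc_inv (basis Triv \<otimes> basis p)) = (B_left \<otimes>\<^sub>m id) (basis p :: _ \<Rightarrow>\<^sub>0 'k)"
    for p :: "pbtree \<times> 'a"
    by (cases p)
      (simp add: assoc_inv_def lin_basis tensor_basis tensor_map_basis vee_def B_left_basis)
qed

lemma coproduct_tree_Graft_Triv_right:
  "coproduct_tree (Graft t Triv) = basis t \<otimes> basis Triv + (id \<otimes>\<^sub>m B_right) (coproduct_tree t)"
  by (simp add: right_graft_Triv linear_free_zero[OF tensor_linear_right]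
      linear_free_zero[OF linear_assoc_inv] linear_free_zero[OF tensor_map_linear])

lemma coproduct_tree_Graft_Triv_left:
  "coproduct_tree (Graft Triv t) = basis Triv \<otimes> basis t + (B_left \<otimes>\<^sub>m id) (coproduct_tree t)"
  by (simp add: left_graft_Triv linear_free_zero[OF tensor_linear_left]
      linear_free_zero[OF linear_assoc] linear_free_zero[OF tensor_map_linear])

theorem proposition3p3:
  fixes T :: "pbtree \<Rightarrow>\<^sub>0 'k::{comm_ring, comm_monoid_mult}"
  shows "coproduct (B_right T) = T \<otimes> basis Triv + (id \<otimes>\<^sub>m B_right) (coproduct T)
    \<and> coproduct (B_left T) = basis Triv \<otimes> T + (B_left \<otimes>\<^sub>m id) (coproduct T)"
proof
  show "coproduct (B_right T) = T \<otimes> basis Triv + (id \<otimes>\<^sub>m B_right) (coproduct T)"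
    by (rule linear_free_eqI[OF is_linear_comp[OF linear_B_right linear_coproduct]
          linear_free_add[OF tensor_linear_left
            is_linear_comp[OF linear_coproduct tensor_map_linear]]])
      (simp only: B_right_basis coproduct_basis coproduct_tree_Graft_Triv_right)
  show "coproduct (B_left T) = basis Triv \<otimes> T + (B_left \<otimes>\<^sub>m id) (coproduct T)"
    by (rule linear_free_eqI[OF is_linear_comp[OF linear_B_left linear_coproduct]
          linear_free_add[OF tensor_linear_right
            is_linear_comp[OF linear_coproduct tensor_map_linear]]])
      (simp only: B_left_basis coproduct_basis coproduct_tree_Graft_Triv_left)
qed

end
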